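(* Let $b > 1$ be a fixed integer. As $n \to \infty$ through even integers, $PD(X_b^n) \to \dfrac{1}{2^{b-1}}$; and as $n \to \infty$ through odd integers, $PD(X_b^n) \to \dfrac{b}{2^{b-1}}$.
   Context: For integers $b > 1$ and $n > 1$, let $X_b$ be a set of $b$ distinct elements, and let $X_b^n$ be the set of all multisets $X = \{x_1,\dots,x_n\}$ of cardinality $n$ (counted with multiplicity) whose elements lie in $X_b$. A multiset $X=\{x_1,\dots,x_n\} \in X_b^n$ is called palindromic if its elements can be arranged into a palindrome, i.e. there exist pairwise distinct indices $i_1,\dots,i_n \in \{1,\dots,n\}$ such that $(x_{i_1},\dots,x_{i_n}) = (x_{i_n},\dots,x_{i_1})$. Let $P_b^n \subset X_b^n$ be the set of palindromic multisets in $X_b^n$. The palindromic density of $X_b^n$ is $PD(X_b^n) := |P_b^n| / |X_b^n|$. *)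

theory Defs
  imports Complex_Main "HOL-Library.Multiset"
begin

definition multisets_of :: "'a set \<Rightarrow> nat \<Rightarrow> 'a multiset set" where
  "multisets_of X n = {M. set_mset M \<subseteq> X \<and> size M = n}"

text \<open>An arrangement of a multiset is a list with that underlying multiset.\<close>

definition palindromic :: "'a multiset \<Rightarrow> bool" where
  "palindromic M \<longleftrightarrow> (\<exists>xs. mset xs = M \<and> rev xs = xs)"

definition palindromic_multisets :: "'a set \<Rightarrow> nat \<Rightarrow> 'a multiset set" where
  "palindromic_multisets X n = {M \<in> multisets_of X n. palindromic M}"

definition palindromic_density :: "'a set \<Rightarrow> nat \<Rightarrow> real" where
  "palindromic_density X n =
     real (card (palindromic_multisets X n)) / real (card (multisets_of X n))"

end

theory Submission
  imports Defs
begin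

text \<open>
  Reading a palindrome up to its middle shows that a multiset is palindromic iff it is a doubled
  multiset \<open>H + H\<close>, or a doubled multiset together with one extra element, the centre. Parity
  makes \<open>H\<close> and the centre unique. Over an alphabet of \<open>b\<close> letters the palindromic multisets of
  size \<open>n\<close> are therefore counted by the multisets of size \<open>n div 2\<close>, with an additional factor
  \<open>b\<close> for the choice of the centre when \<open>n\<close> is odd (lemma \<open>card_palindromic_multisets\<close>).

  Put \<open>k = b - 1\<close>. There are \<open>(n + k) choose n\<close> multisets of size \<open>n\<close>, which is a polynomial
  \<open>(n + 1) \<cdots> (n + k) / k!\<close> of degree \<open>k\<close> in \<open>n\<close>. Halving the size thus divides the number of
  multisets by \<open>2 ^ k\<close> in the limit, and this holds for \<open>n div 2\<close> along the whole sequence, so that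
  parity enters the density only through the factor \<open>1\<close> or \<open>b\<close> (lemmas
  \<open>palindromic_density_eq_prod\<close> and \<open>half_ratio_tendsto\<close>).
\<close>

lemma multisets_of_0: "multisets_of X 0 = {{#}}"
  by (auto simp: multisets_of_def)

text \<open>
  Pascal's rule for multisets: unlike for sets, removing one copy of \<open>a\<close> leaves \<open>a\<close> available,
  so that the second part keeps the full alphabet \<open>insert a X\<close>.
\<close>

lemma multisets_of_insert_Suc:
  "multisets_of (insert a X) (Suc n) =
     multisets_of (X - {a}) (Suc n) \<union> add_mset a ` multisets_of (insert a X) n"
proof (intro equalityI subsetI)
  fix M assume M: "M \<in> multisets_of (insert a X) (Suc n)"
  show "M \<in> multisets_of (X - {a}) (Suc n) \<union> add_mset a ` multisets_of (insert a X) n"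
  proof (cases "a \<in># M")
    case True
    then obtain N where "M = add_mset a N"
      by (metis mset_add)
    with M show ?thesis
      by (auto simp: multisets_of_def)
  next
    case False
    with M show ?thesis
      by (auto simp: multisets_of_def)
  qed
qed (auto simp: multisets_of_def)

text \<open>
  Truncated subtraction makes the formula hold for the empty alphabet too: it gives \<open>1\<close> for
  \<open>n = 0\<close> and \<open>(n - 1) choose n = 0\<close> otherwise. The induction can thus start there.
\<close>

lemma finite_card_multisets_of:
  assumes "finite X"
  shows "finite (multisets_of X n) \<and> card (multisets_of X n) = (n + card X - 1) choose n"
  using assms
proof (induction X arbitrary: n rule: finite_induct)
  case empty
  show ?case
    by (cases n) (simp_all add: multisets_of_def cong: conj_cong)
next
  case (insert a X)
  show ?case
  proof (induction n)
    case 0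
    show ?case by (simp add: multisets_of_0)
  next
    case (Suc n)
    have split: "multisets_of (insert a X) (Suc n) =
        multisets_of X (Suc n) \<union> add_mset a ` multisets_of (insert a X) n"
      using multisets_of_insert_Suc[of a X n] insert.hyps by simp
    have disj: "multisets_of X (Suc n) \<inter> add_mset a ` multisets_of (insert a X) n = {}"
      using insert.hyps by (auto simp: multisets_of_def)
    have "card (multisets_of (insert a X) (Suc n)) =
        card (multisets_of X (Suc n)) + card (multisets_of (insert a X) n)"
      unfolding split using insert.IH[of "Suc n"] Suc.IH disj
      by (simp add: card_Un_disjoint card_image inj_on_def)
    then show ?case
      using insert.IH[of "Suc n"] Suc.IH insert.hyps by (simp add: split)
  qed
qed

lemma card_multisets_of_eq_prod:
  assumes "finite X" and "card X = Suc k"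
  shows "real (card (multisets_of X n)) = (\<Prod>i<k. real (n + i + 1)) / fact k"
proof -
  have "card (multisets_of X n) = (n + k) choose k"
    using finite_card_multisets_of[OF assms(1), of n] assms(2) binomial_symmetric[of k "n + k"]
    by simp
  then show ?thesis
    by (simp add: binomial_gbinomial gbinomial_pochhammer' pochhammer_prod lessThan_atLeast0
        add_ac)
qed

text \<open>
  A palindrome is its first half, followed by the middle entry if the length is odd, followed by
  the reversed first half. Both halves have the same multiset \<open>H\<close>, and any list with multiset
  \<open>H\<close> can serve as first half in the converse direction.
\<close>

lemma palindromic_iff_double:
  "palindromic M \<longleftrightarrow> (\<exists>H. M = H + H \<or> (\<exists>x. M = add_mset x (H + H)))"
proof
  assume "palindromic M"
  then obtain xs where xs: "mset xs = M" "rev xs = xs"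
    by (auto simp: palindromic_def)
  define m where "m = length xs div 2"
  define l where "l = take m xs"
  show "\<exists>H. M = H + H \<or> (\<exists>x. M = add_mset x (H + H))"
  proof (cases "even (length xs)")
    case True
    then have "drop m xs = rev l"
      using xs(2) rev_drop[of m xs] by (metis l_def m_def rev_rev_ident
          dvd_mult_div_cancel mult_2 add_diff_cancel_left')
    then have "xs = l @ rev l"
      by (metis append_take_drop_id l_def)
    then have "M = mset l + mset l"
      using xs(1) by (metis mset_append mset_rev)
    then show ?thesis by blast
  next
    case False
    then have len: "length xs = Suc (m + m)"
      unfolding m_def by presburger
    then have "xs = l @ xs ! m # drop (Suc m) xs"
      by (simp add: l_def id_take_nth_drop)
    moreover have "drop (Suc m) xs = rev l"
      using xs(2) rev_drop[of "Suc m" xs] len by (metis l_def rev_rev_ident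
          add_Suc add_diff_cancel_left')
    ultimately have "xs = l @ xs ! m # rev l" by simp
    then have "M = mset (l @ xs ! m # rev l)"
      using xs(1) by simp
    then have "M = add_mset (xs ! m) (mset l + mset l)"
      by simp
    then show ?thesis by blast
  qed
next
  assume "\<exists>H. M = H + H \<or> (\<exists>x. M = add_mset x (H + H))"
  then obtain H where H: "M = H + H \<or> (\<exists>x. M = add_mset x (H + H))"
    by blast
  obtain l where l: "mset l = H"
    using ex_mset by blast
  from H show "palindromic M"
  proof (elim disjE exE)
    assume "M = H + H"
    then show ?thesis
      using l by (auto simp: palindromic_def intro!: exI[of _ "l @ rev l"])
  next
    fix x assume "M = add_mset x (H + H)"
    then show ?thesis
      using l by (auto simp: palindromic_def intro!: exI[of _ "l @ x # rev l"])
  qed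
qed

lemma palindromic_multisets_even:
  assumes "even n"
  shows "palindromic_multisets X n = (\<lambda>H. H + H) ` multisets_of X (n div 2)"
proof (intro equalityI subsetI)
  fix M assume "M \<in> palindromic_multisets X n"
  then obtain H where M: "set_mset M \<subseteq> X" "size M = n"
      and H: "M = H + H \<or> (\<exists>x. M = add_mset x (H + H))"
    by (auto simp: palindromic_multisets_def multisets_of_def palindromic_iff_double)
  from H M(2) assms have "M = H + H"
    by auto
  with M show "M \<in> (\<lambda>H. H + H) ` multisets_of X (n div 2)"
    by (auto simp: multisets_of_def)
qed (use assms in \<open>auto simp: palindromic_multisets_def multisets_of_def palindromic_iff_double\<close>)

lemma palindromic_multisets_odd:
  assumes "odd n"
  shows "palindromic_multisets X n =
    (\<lambda>(x, H). add_mset x (H + H)) ` (X \<times> multisets_of X (n div 2))"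
proof (intro equalityI subsetI)
  fix M assume "M \<in> palindromic_multisets X n"
  then obtain H where M: "set_mset M \<subseteq> X" "size M = n"
      and H: "M = H + H \<or> (\<exists>x. M = add_mset x (H + H))"
    by (auto simp: palindromic_multisets_def multisets_of_def palindromic_iff_double)
  from H M(2) assms obtain x where x: "M = add_mset x (H + H)"
    by auto
  have "size H = n div 2"
    using x M(2) by simp
  then have "(x, H) \<in> X \<times> multisets_of X (n div 2)"
    using x M(1) by (simp add: multisets_of_def)
  then show "M \<in> (\<lambda>(x, H). add_mset x (H + H)) ` (X \<times> multisets_of X (n div 2))"
    unfolding x by (rule rev_image_eqI) simp
next
  fix M assume "M \<in> (\<lambda>(x, H). add_mset x (H + H)) ` (X \<times> multisets_of X (n div 2))"
  then obtain x H where "x \<in> X" "set_mset H \<subseteq> X" "size H = n div 2" "M = add_mset x (H + H)"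
    by (auto simp: multisets_of_def)
  moreover have "Suc (n div 2 + n div 2) = n"
    using assms by presburger
  ultimately show "M \<in> palindromic_multisets X n"
    by (auto simp: palindromic_multisets_def multisets_of_def palindromic_iff_double)
qed

lemma double_multiset_inj: "H + H = K + K \<Longrightarrow> H = (K :: 'a multiset)"
  by (simp add: multiset_eq_iff) (metis add_self_div_2)

text \<open>The centre is recovered as the only element of odd multiplicity.\<close>

lemma centre_double_multiset_inj:
  fixes H K :: "'a multiset"
  assumes eq: "add_mset x (H + H) = add_mset y (K + K)"
  shows "x = y \<and> H = K"
proof -
  have "x = y"
  proof (rule ccontr)
    assume "x \<noteq> y"
    have "Suc (count H x + count H x) = count (add_mset y (K + K)) x"
      unfolding eq[symmetric] by simp
    also have "\<dots> = count K x + count K x"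
      using \<open>x \<noteq> y\<close> by simp
    finally show False
      by presburger
  qed
  with eq show ?thesis
    using double_multiset_inj by auto
qed

lemma card_palindromic_multisets:
  "card (palindromic_multisets X n) =
     (if even n then 1 else card X) * card (multisets_of X (n div 2))"
proof (cases "even n")
  case True
  then show ?thesis
    by (auto simp: palindromic_multisets_even intro!: card_image inj_onI dest: double_multiset_inj)
next
  case False
  have "inj_on (\<lambda>(x, H). add_mset x (H + H)) (X \<times> multisets_of X (n div 2))"
    by (auto intro!: inj_onI dest!: centre_double_multiset_inj)
  with False show ?thesis
    by (simp add: palindromic_multisets_odd card_image card_cartesian_product)
qed

lemma palindromic_density_eq_prod:
  assumes "finite X" and "card X = Suc k"
  shows "palindromic_density X n =
    (if even n then 1 else real (card X)) * (\<Prod>i<k. real (n div 2 + i + 1) / real (n + i + 1))"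
  by (simp add: palindromic_density_def card_palindromic_multisets
      card_multisets_of_eq_prod[OF assms] prod_dividef)

text \<open>
  Writing \<open>n = 2 * q + r\<close> with \<open>r \<le> 1\<close>, the numerator \<open>q + i + 1\<close> differs from half the
  denominator by the bounded quantity \<open>(i + 1 - r) / 2\<close>, so the deviation from \<open>1 / 2\<close> is
  \<open>O(1 / n)\<close> for both parities at once.
\<close>

lemma half_ratio_tendsto:
  "(\<lambda>n. real (n div 2 + i + 1) / real (n + i + 1)) \<longlonglongrightarrow> 1 / 2"
proof -
  have bound: "norm (real (n div 2 + i + 1) / real (n + i + 1) - 1 / 2) \<le>
      norm (inverse (real (Suc n))) * real (i + 1)" for n
  proof -
    define q r where "q = n div 2" and "r = n mod 2"
    have n: "n = 2 * q + r" and "r \<le> 1"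
      by (simp_all add: q_def r_def)
    have "real (q + i + 1) / real (n + i + 1) - 1 / 2 =
        (real (i + 1) - real r) / (2 * real (n + i + 1))"
      unfolding n by (simp add: field_simps)
    also have "norm \<dots> \<le> real (i + 1) / real (Suc n)"
      unfolding real_norm_def abs_divide using \<open>r \<le> 1\<close> by (intro frac_le) auto
    also have "\<dots> = norm (inverse (real (Suc n))) * real (i + 1)"
      unfolding real_norm_def by (subst abs_of_nonneg) (simp_all only: divide_inverse mult.commute
          inverse_nonnegative_iff_nonnegative of_nat_0_le_iff)
    finally show ?thesis
      unfolding q_def .
  qed
  have "(\<lambda>n. real (n div 2 + i + 1) / real (n + i + 1) - 1 / 2) \<longlonglongrightarrow> 0"
    by (rule tendsto_0_le[OF LIMSEQ_inverse_real_of_nat always_eventually[OF allI[OF bound]]])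
  then show ?thesis
    by (rule LIM_zero_cancel)
qed

theorem theorem5p3:
  fixes X :: "'a set" and b :: nat
  assumes "b > 1" and "finite X" and "card X = b"
  shows "(palindromic_density X \<longlongrightarrow> 1 / 2 ^ (b - 1)) (inf sequentially (principal {n. even n}))
       \<and> (palindromic_density X \<longlongrightarrow> real b / 2 ^ (b - 1)) (inf sequentially (principal {n. odd n}))"
proof -
  define P where
    "P = (\<lambda>n. \<Prod>i<b - 1. real (n div 2 + i + 1) / real (n + i + 1))"
  have "P \<longlonglongrightarrow> (\<Prod>i<b - 1. 1 / 2)"
    unfolding P_def by (intro tendsto_prod half_ratio_tendsto)
  then have P: "P \<longlonglongrightarrow> 1 / 2 ^ (b - 1)"
    by (simp add: power_one_over)
  have density: "palindromic_density X n = (if even n then 1 else real b) * P n" for n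
    using palindromic_density_eq_prod[of X "b - 1" n] assms by (simp add: P_def)
  \<comment> \<open>On a set of indices where the parity factor is constant, the density inherits the limit of
    \<open>P\<close> along the whole sequence.\<close>
  have restrict: "(palindromic_density X \<longlongrightarrow> c * (1 / 2 ^ (b - 1))) (inf sequentially (principal S))"
    if "\<And>n. n \<in> S \<Longrightarrow> palindromic_density X n = c * P n" for c S
  proof -
    have "((\<lambda>n. c * P n) \<longlongrightarrow> c * (1 / 2 ^ (b - 1))) (inf sequentially (principal S))"
      by (rule tendsto_mono[OF inf_le1 tendsto_mult_left[OF P]])
    moreover have "eventually (\<lambda>n. c * P n = palindromic_density X n)
        (inf sequentially (principal S))"
      using that by (auto simp: eventually_inf_principal)
    ultimately show ?thesis
      by (rule Lim_transform_eventually)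
  qed
  show ?thesis
    using restrict[of "{n. even n}" 1] restrict[of "{n. odd n}" "real b"] by (simp add: density)
qed

end
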